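(* Let $\Gamma$ be a labeled directed graph. If $\Gamma$ is amenable but contains a nonamenable subgraph $P$, then for any right-invariant measure $\mu$ on $\Gamma$, $\mu(P)=0$ (where $P$ is identified with its vertex set).
   Context: A labeled directed graph is a directed graph of bounded degree, each of whose edges is labeled by an element of a finite set $\{g_1,\dots,g_n\}$, such that each vertex has at most one incoming edge and at most one outgoing edge with each label (a vertex need not have an edge with each label). A subgraph inherits its directions and labels. A set $S$ of vertices of $\Gamma$ is $g_i$-translatable if each vertex in $S$ has an outgoing edge labeled $g_i$; then $Sg_i$ denotes the set of vertices at the other ends of the outgoing $g_i$-labeled edges from vertices of $S$. A right-invariant measure on $\Gamma$ is a finitely additive measure $\mu$ (with values in $[0,1]$) defined on all subsets of the vertex set of $\Gamma$, with $\mu(\Gamma)=1$, such that for each $g_i$ and each $g_i$-translatable set $S$ of vertices, $\mu(S)=\mu(Sg_i)$. A graph of bounded degree is amenable (in the Følner sense) if for every $\epsilon>0$ there is a finite nonempty set $A$ of its vertices with $\#\partial(A)/\#A<\epsilon$, where $\#\partial(A)$ is the number of edges of the graph connecting a vertex in $A$ to a vertex of the graph outside $A$ (edge directions are ignored); otherwise it is nonamenable. *)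

theory Defs
  imports "HOL-Analysis.Analysis" "Graph_Theory.Digraph_Component"
begin

text \<open>
  Loops count twice, once as incoming and once as outgoing arc; the finiteness
  conjuncts are needed because an infinite set of arcs has cardinality 0.
\<close>

definition bounded_degree :: "('a, 'b) pre_digraph \<Rightarrow> bool" where
  "bounded_degree G \<longleftrightarrow>
     (\<exists>d. \<forall>v\<in>verts G. finite (in_arcs G v) \<and> finite (out_arcs G v) \<and>
        in_degree G v + out_degree G v \<le> d)"

text \<open>
  The label set \<open>L\<close> is the set of the generators \<open>g\<^sub>1, \<dots>, g\<^sub>n\<close>. Bounded degree
  already follows from the other axioms.
\<close>

locale labeled_digraph = wf_digraph G
  for G :: "('a, 'b) pre_digraph" (structure) +
  fixes lab :: "'b \<Rightarrow> 'l" and L :: "'l set"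
  assumes bounded_degree: "bounded_degree G"
    and finite_labels: "finite L"
    and lab_in: "e \<in> arcs G \<Longrightarrow> lab e \<in> L"
    and out_unique: "\<lbrakk>e \<in> arcs G; e' \<in> arcs G; tail G e = tail G e'; lab e = lab e'\<rbrakk> \<Longrightarrow> e = e'"
    and in_unique: "\<lbrakk>e \<in> arcs G; e' \<in> arcs G; head G e = head G e'; lab e = lab e'\<rbrakk> \<Longrightarrow> e = e'"

text \<open>A subgraph inherits its labels by using the same labeling function.\<close>

lemma labeled_digraph_subgraph:
  assumes "labeled_digraph G lab L" and "subgraph H G"
  shows "labeled_digraph H lab L"
proof -
  interpret G: labeled_digraph G lab L by fact
  have wf: "wf_digraph H" and vs: "verts H \<subseteq> verts G" and as: "arcs H \<subseteq> arcs G"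
    and ends: "tail H = tail G" "head H = head G"
    using assms(2) by (auto simp: subgraph_def compatible_def)
  obtain d where d: "\<And>v. v \<in> verts G \<Longrightarrow> finite (in_arcs G v) \<and> finite (out_arcs G v) \<and>
        in_degree G v + out_degree G v \<le> d"
    using G.bounded_degree by (auto simp: bounded_degree_def)
  have "finite (in_arcs H v) \<and> finite (out_arcs H v) \<and> in_degree H v + out_degree H v \<le> d"
    if "v \<in> verts H" for v
  proof -
    have sub: "in_arcs H v \<subseteq> in_arcs G v" "out_arcs H v \<subseteq> out_arcs G v"
      using as ends by (auto simp: in_arcs_def out_arcs_def)
    have fin: "finite (in_arcs G v)" "finite (out_arcs G v)"
      and le: "in_degree G v + out_degree G v \<le> d"
      using d that vs by blast+
    have "in_degree H v \<le> in_degree G v" "out_degree H v \<le> out_degree G v"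
      unfolding in_degree_def out_degree_def using sub fin by (auto intro: card_mono)
    with le sub fin show ?thesis by (auto intro: finite_subset)
  qed
  then have "bounded_degree H" by (auto simp: bounded_degree_def)
  with wf as ends show ?thesis
    by (auto simp: labeled_digraph_def labeled_digraph_axioms_def G.finite_labels subset_iff
        intro: G.lab_in G.out_unique G.in_unique)
qed

definition translatable ::
  "('a, 'b) pre_digraph \<Rightarrow> ('b \<Rightarrow> 'l) \<Rightarrow> 'l \<Rightarrow> 'a set \<Rightarrow> bool" where
  "translatable G lab g S \<longleftrightarrow>
     S \<subseteq> verts G \<and> (\<forall>v\<in>S. \<exists>e\<in>out_arcs G v. lab e = g)"

definition translate ::
  "('a, 'b) pre_digraph \<Rightarrow> ('b \<Rightarrow> 'l) \<Rightarrow> 'a set \<Rightarrow> 'l \<Rightarrow> 'a set" where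
  "translate G lab S g = head G ` {e \<in> arcs G. tail G e \<in> S \<and> lab e = g}"

text \<open>Values of \<open>\<mu>\<close> on sets that are not contained in \<open>verts G\<close> are irrelevant.\<close>

definition right_invariant_measure ::
  "('a, 'b) pre_digraph \<Rightarrow> ('b \<Rightarrow> 'l) \<Rightarrow> 'l set \<Rightarrow> ('a set \<Rightarrow> real) \<Rightarrow> bool" where
  "right_invariant_measure G lab L \<mu> \<longleftrightarrow>
     (\<forall>S\<subseteq>verts G. \<mu> S \<in> {0..1}) \<and>
     additive (Pow (verts G)) \<mu> \<and>
     \<mu> (verts G) = 1 \<and>
     (\<forall>g\<in>L. \<forall>S. translatable G lab g S \<longrightarrow> \<mu> S = \<mu> (translate G lab S g))"

definition edge_boundary :: "('a, 'b) pre_digraph \<Rightarrow> 'a set \<Rightarrow> 'b set" where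
  "edge_boundary G A =
     {e \<in> arcs G. tail G e \<in> A \<and> head G e \<in> verts G - A \<or>
                  head G e \<in> A \<and> tail G e \<in> verts G - A}"

text \<open>Only meaningful for graphs of bounded degree, where all boundaries are finite.\<close>

definition amenable :: "('a, 'b) pre_digraph \<Rightarrow> bool" where
  "amenable G \<longleftrightarrow>
     (\<forall>\<epsilon>::real. \<epsilon> > 0 \<longrightarrow>
        (\<exists>A\<subseteq>verts G. finite A \<and> A \<noteq> {} \<and>
           real (card (edge_boundary G A)) / real (card A) < \<epsilon>))"

end

(* Nonamenability of P makes closed neighbourhoods of finite vertex sets
   expand by a factor (q + 1) / q, so by the marriage theorem q + 1 copies of P inject into q
   copies of P while moving every vertex along at most one edge. Such injections are piecewise
   translations by a generator or its inverse and hence preserve every right-invariant measure,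
   so (q + 1) * \<mu>(P) \<le> q * \<mu>(P). *)

theory Submission
  imports Defs
begin

section \<open>Hall's marriage theorem for locally finite relations\<close>

text \<open>
  Rado's argument: an edge set that is minimal subject to Hall's condition is the graph of a
  function. This needs no separate treatment of finite sets.
\<close>

theorem hall_locally_finite:
  fixes E :: "('a \<times> 'b) set"
  assumes fin: "\<And>x. x \<in> X \<Longrightarrow> finite (E `` {x})"
    and hall: "\<And>B. finite B \<Longrightarrow> B \<subseteq> X \<Longrightarrow> card B \<le> card (E `` B)"
  obtains f where "inj_on f X" and "\<And>x. x \<in> X \<Longrightarrow> (x, f x) \<in> E"
proof -
  define H where "H F \<longleftrightarrow> (\<forall>B. finite B \<and> B \<subseteq> X \<longrightarrow> card B \<le> card (F `` B))"
    for F :: "('a \<times> 'b) set"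
  have fin_image: "finite (F `` B)" if "F \<subseteq> E" "finite B" "B \<subseteq> X" for F B
  proof (rule finite_subset)
    show "F `` B \<subseteq> (\<Union>x\<in>B. E `` {x})" using that by auto
    show "finite (\<Union>x\<in>B. E `` {x})" using that fin by blast
  qed
  \<comment> \<open>Zorn's lemma is applied to the set \<open>R\<close> of deleted edges, ordered by
    inclusion; a maximal deletion leaves a minimal edge set satisfying Hall's condition.\<close>
  have "\<exists>M\<in>{R. H (E - R)}. \<forall>R\<in>{R. H (E - R)}. M \<subseteq> R \<longrightarrow> R = M"
  proof (rule subset_Zorn')
    fix C assume chain: "subset.chain {R. H (E - R)} C"
    show "\<Union>C \<in> {R. H (E - R)}"
    proof (cases "C = {}")
      case True
      then show ?thesis using hall by (simp add: H_def)
    next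
      case False
      have "card B \<le> card ((E - \<Union>C) `` B)" if B: "finite B" "B \<subseteq> X" for B
      proof -
        \<comment> \<open>By local finiteness only finitely many edges start in \<open>B\<close>.
          Those deleted by the whole chain are therefore already deleted by a single member
          \<open>R\<close>, which satisfies Hall's condition at \<open>B\<close>.\<close>
        have "E \<inter> (B \<times> UNIV) \<subseteq> B \<times> E `` B" by auto
        then have "finite (E \<inter> (B \<times> UNIV) \<inter> \<Union>C)"
          using B fin_image[of E B] by (meson finite_Int finite_SigmaI finite_subset order_refl)
        then obtain R where R: "R \<in> C" "E \<inter> (B \<times> UNIV) \<inter> \<Union>C \<subseteq> R"
          using finite_subset_Union_chain[OF _ _ False chain] by (metis inf_le2)
        then have "(E - \<Union>C) `` B = (E - R) `` B" by auto
        moreover have "H (E - R)" using R chain by (auto simp: subset.chain_def)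
        ultimately show ?thesis using B by (simp add: H_def)
      qed
      then show ?thesis by (simp add: H_def)
    qed
  qed
  then obtain M where M: "H (E - M)" and max: "\<And>R. H (E - R) \<Longrightarrow> M \<subseteq> R \<Longrightarrow> R = M"
    by auto
  define F where "F = E - M"
  have HF: "card B \<le> card (F `` B)" if "finite B" "B \<subseteq> X" for B
    using M that by (simp add: H_def F_def)
  have FE: "F \<subseteq> E" by (auto simp: F_def)
  \<comment> \<open>By maximality of \<open>M\<close>, deleting one more edge breaks Hall's
    condition at some finite \<open>I\<close>. This \<open>I\<close> contains \<open>x\<close>,
    since otherwise its image would not change.\<close>
  have critical: "\<exists>I. finite I \<and> I \<subseteq> X \<and> x \<in> I \<and> card ((F - {(x, a)}) `` I) < card I"
    if "(x, a) \<in> F" for x a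
  proof -
    have "\<not> H (E - insert (x, a) M)" using max[of "insert (x, a) M"] that by (auto simp: F_def)
    moreover have "E - insert (x, a) M = F - {(x, a)}" by (auto simp: F_def)
    ultimately obtain I where I: "finite I" "I \<subseteq> X" "card ((F - {(x, a)}) `` I) < card I"
      unfolding H_def by (metis not_le)
    have "x \<in> I"
    proof (rule ccontr)
      assume "x \<notin> I"
      then have "(F - {(x, a)}) `` I = F `` I" by auto
      then show False using I HF[of I] by simp
    qed
    with I show ?thesis by blast
  qed
  \<comment> \<open>Submodular counting: if \<open>x\<close> kept two edges, the critical sets
    \<open>I\<close> and \<open>J\<close> would give |I \<union> J| + |I \<inter> J| - 1 \<le> |P| +
    |Q| \<le> |I| + |J| - 2, where P and Q are the images \<open>?P\<close> and
    \<open>?Q\<close>.\<close>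
  have single: "a = b" if xa: "(x, a) \<in> F" and xb: "(x, b) \<in> F" for x a b
  proof (rule ccontr)
    assume "a \<noteq> b"
    obtain I where I: "finite I" "I \<subseteq> X" "x \<in> I" "card ((F - {(x, a)}) `` I) < card I"
      using critical[OF xa] by blast
    obtain J where J: "finite J" "J \<subseteq> X" "x \<in> J" "card ((F - {(x, b)}) `` J) < card J"
      using critical[OF xb] by blast
    let ?P = "(F - {(x, a)}) `` I" and ?Q = "(F - {(x, b)}) `` J"
    have finP: "finite ?P" and finQ: "finite ?Q"
      using FE I J by (auto intro!: fin_image)
    \<comment> \<open>Neither deletion loses a point here: \<open>b\<close> survives in
      \<open>?P\<close> and \<open>a\<close> in \<open>?Q\<close>, because \<open>x\<close> lies in
      both \<open>I\<close> and \<open>J\<close>.\<close>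
    have "F `` (I \<union> J) \<subseteq> ?P \<union> ?Q" using \<open>a \<noteq> b\<close> I(3) J(3) xa xb by blast
    then have "card (I \<union> J) \<le> card (?P \<union> ?Q)"
      using HF[of "I \<union> J"] I J finP finQ
      by (meson card_mono finite_UnI le_sup_iff order_trans)
    \<comment> \<open>Removing \<open>x\<close> keeps both deleted edges out of play, at the cost of
      one element.\<close>
    moreover have "F `` (I \<inter> J - {x}) \<subseteq> ?P \<inter> ?Q" by auto
    then have "card (I \<inter> J - {x}) \<le> card (?P \<inter> ?Q)"
      using HF[of "I \<inter> J - {x}"] I J finP
      by (meson card_mono finite_Diff finite_Int le_infI1 Diff_subset order_trans)
    moreover have "card (I \<inter> J - {x}) = card (I \<inter> J) - 1" "card (I \<inter> J) > 0"
      using I J by (auto simp: card_gt_0_iff)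
    moreover have "card ?P + card ?Q = card (?P \<union> ?Q) + card (?P \<inter> ?Q)"
      by (rule card_Un_Int[OF finP finQ])
    moreover have "card I + card J = card (I \<union> J) + card (I \<inter> J)"
      by (rule card_Un_Int[OF I(1) J(1)])
    ultimately show False using I(4) J(4) by linarith
  qed
  have "\<exists>y. (x, y) \<in> F" if "x \<in> X" for x
  proof -
    have "F `` {x} \<noteq> {}" using HF[of "{x}"] that by (metis card.empty card_1_singleton_iff
        empty_subsetI finite.emptyI finite.insertI insert_subset not_one_le_zero One_nat_def)
    then show ?thesis by auto
  qed
  then obtain f where f: "\<And>x. x \<in> X \<Longrightarrow> (x, f x) \<in> F" by metis
  have "inj_on f X"
  proof (rule inj_onI, rule ccontr)
    fix x y assume xy: "x \<in> X" "y \<in> X" "f x = f y" "x \<noteq> y"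
    then have "F `` {x, y} \<subseteq> {f x}" using f single by auto
    then have "card (F `` {x, y}) \<le> 1" using card_mono[of "{f x}"] by simp
    then show False using HF[of "{x, y}"] xy by simp
  qed
  with f FE that show thesis by blast
qed

section \<open>Expansion of neighbourhoods in nonamenable graphs\<close>

text \<open>Labels and directions are forgotten, as in \<open>edge_boundary\<close>. The diagonal
  makes neighbourhoods closed, so that a finite set and its outer vertex boundary add up to its
  image.\<close>

definition nbr :: "('a, 'b) pre_digraph \<Rightarrow> ('a \<times> 'a) set" where
  "nbr G = Id_on (verts G) \<union> arcs_ends G \<union> (arcs_ends G)\<inverse>"

lemma (in wf_digraph) nbr_subset: "nbr G \<subseteq> verts G \<times> verts G"
  by (auto simp: nbr_def arcs_ends_def arc_to_ends_def)

lemma nbr_mono: "subgraph H G \<Longrightarrow> nbr H \<subseteq> nbr G"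
  by (auto simp: nbr_def subgraph_def compatible_def arcs_ends_def arc_to_ends_def)

lemma (in wf_digraph) finite_nbr:
  assumes "bounded_degree G" and "v \<in> verts G"
  shows "finite (nbr G `` {v})"
proof (rule finite_subset)
  show "nbr G `` {v} \<subseteq> {v} \<union> head G ` out_arcs G v \<union> tail G ` in_arcs G v"
    by (auto simp: nbr_def arcs_ends_def arc_to_ends_def)
  show "finite ({v} \<union> head G ` out_arcs G v \<union> tail G ` in_arcs G v)"
    using assms by (auto simp: bounded_degree_def)
qed

text \<open>Every boundary edge of \<open>A\<close> ends in the outer vertex boundary
  \<open>D\<close>, and a vertex of \<open>D\<close> meets at most \<open>d\<close> edges. Hence
  \<epsilon> |A| \<le> d |D|, and any q \<ge> d / \<epsilon> gives |A| \<le> q |D|.\<close>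

lemma (in wf_digraph) nonamenable_expansion:
  assumes bd: "bounded_degree G" and na: "\<not> amenable G"
  obtains q :: nat
  where "\<And>A. finite A \<Longrightarrow> A \<subseteq> verts G \<Longrightarrow> Suc q * card A \<le> q * card (nbr G `` A)"
proof -
  obtain d where d: "\<And>v. v \<in> verts G \<Longrightarrow> finite (in_arcs G v) \<and> finite (out_arcs G v) \<and>
        in_degree G v + out_degree G v \<le> d"
    using bd by (auto simp: bounded_degree_def)
  obtain \<epsilon> :: real where \<epsilon>: "\<epsilon> > 0"
    and bdry: "\<And>A. A \<subseteq> verts G \<Longrightarrow> finite A \<Longrightarrow> A \<noteq> {} \<Longrightarrow>
      \<epsilon> \<le> real (card (edge_boundary G A)) / real (card A)"
    using na unfolding amenable_def by (meson not_less)
  obtain q :: nat where q: "real d / \<epsilon> \<le> real q" using real_arch_simple by blast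
  have "Suc q * card A \<le> q * card (nbr G `` A)" if A: "finite A" "A \<subseteq> verts G" for A
  proof -
    define D where "D = nbr G `` A - A"
    have sub: "A \<subseteq> nbr G `` A" using A by (auto simp: nbr_def)
    have finN: "finite (nbr G `` A)"
    proof -
      have "nbr G `` A = (\<Union>v\<in>A. nbr G `` {v})" by auto
      moreover have "finite (\<Union>v\<in>A. nbr G `` {v})"
        using A finite_nbr[OF bd] by (intro finite_UN_I) auto
      ultimately show ?thesis by simp
    qed
    have DV: "finite D" "D \<subseteq> verts G" using finN nbr_subset by (auto simp: D_def)
    have "edge_boundary G A \<subseteq> (\<Union>w\<in>D. in_arcs G w \<union> out_arcs G w)"
    proof
      fix e assume "e \<in> edge_boundary G A"
      then have "e \<in> arcs G" and cut: "tail G e \<in> A \<and> head G e \<notin> A \<or> head G e \<in> A \<and> tail G e \<notin> A"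
        by (auto simp: edge_boundary_def)
      then have "(tail G e, head G e) \<in> nbr G" and "(head G e, tail G e) \<in> nbr G"
        by (auto simp: nbr_def arcs_ends_def arc_to_ends_def)
      with cut have "head G e \<in> D \<or> tail G e \<in> D" by (auto simp: D_def)
      with \<open>e \<in> arcs G\<close> show "e \<in> (\<Union>w\<in>D. in_arcs G w \<union> out_arcs G w)" by auto
    qed
    moreover have "finite (\<Union>w\<in>D. in_arcs G w \<union> out_arcs G w)" using DV d by blast
    ultimately have "card (edge_boundary G A) \<le> card (\<Union>w\<in>D. in_arcs G w \<union> out_arcs G w)"
      by (rule card_mono[rotated])
    also have "\<dots> \<le> (\<Sum>w\<in>D. card (in_arcs G w \<union> out_arcs G w))"
      by (rule card_UN_le[OF DV(1)])
    also have "\<dots> \<le> (\<Sum>w\<in>D. d)"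
      using d DV by (intro sum_mono)
        (metis card_Un_le in_degree_def out_degree_def order_trans subsetD)
    finally have upper: "card (edge_boundary G A) \<le> d * card D" by (simp add: mult.commute)
    have "card A \<le> q * card D"
    proof (cases "A = {}")
      case False
      then have "\<epsilon> * card A \<le> card (edge_boundary G A)"
        using bdry[OF A(2,1) False] A by (simp add: field_simps card_gt_0_iff)
      also have "\<dots> \<le> real d * card D" using upper by (metis of_nat_le_iff of_nat_mult)
      also have "\<dots> \<le> (\<epsilon> * q) * card D"
        using q \<epsilon> by (intro mult_right_mono) (auto simp: field_simps)
      finally have "real (card A) \<le> real (q * card D)" using \<epsilon> by simp
      then show ?thesis by linarith
    qed simp
    moreover have "card (nbr G `` A) = card A + card D"
      using sub finN A by (simp add: D_def card_Diff_subset card_mono)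
    ultimately show ?thesis by (simp add: algebra_simps)
  qed
  with that show thesis by blast
qed

text \<open>The expansion factor (q + 1) / q is exactly Hall's condition for matching q + 1 copies
  of the vertex set, indexed by \<open>{..q}\<close>, into q copies, indexed by
  \<open>{..<q}\<close>.\<close>

lemma nonamenable_injection:
  assumes "wf_digraph G" and bd: "bounded_degree G" and "\<not> amenable G"
  obtains q :: nat and \<phi> :: "'a \<times> nat \<Rightarrow> 'a \<times> nat"
  where "inj_on \<phi> (verts G \<times> {..q})"
    and "\<And>v i. v \<in> verts G \<Longrightarrow> i \<le> q \<Longrightarrow> (v, fst (\<phi> (v, i))) \<in> nbr G \<and> snd (\<phi> (v, i)) < q"
proof -
  interpret wf_digraph G by fact
  obtain q :: nat
    where q: "\<And>A. finite A \<Longrightarrow> A \<subseteq> verts G \<Longrightarrow> Suc q * card A \<le> q * card (nbr G `` A)"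
    using nonamenable_expansion[OF bd \<open>\<not> amenable G\<close>] by blast
  \<comment> \<open>Only the vertex is constrained by adjacency; the target copy \<open>j\<close> is
    free. So the image of \<open>B\<close> depends only on its projection, and Hall's condition need
    only be checked for full stacks of copies.\<close>
  define E where "E = {((v, i :: nat), (w, j)) | v i w j. (v, w) \<in> nbr G \<and> j < q}"
  have E_image: "E `` B = nbr G `` (fst ` B) \<times> {..<q}" for B
    by (force simp: E_def)
  obtain \<phi> where \<phi>: "inj_on \<phi> (verts G \<times> {..q})" "\<And>x. x \<in> verts G \<times> {..q} \<Longrightarrow> (x, \<phi> x) \<in> E"
  proof (rule hall_locally_finite[of "verts G \<times> {..q}" E])
    show "finite (E `` {x})" if "x \<in> verts G \<times> {..q}" for x
      using that finite_nbr[OF bd] by (auto simp: E_image)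
    show "card B \<le> card (E `` B)" if B: "finite B" "B \<subseteq> verts G \<times> {..q}" for B
    proof -
      have "B \<subseteq> fst ` B \<times> {..q}" using B by force
      then have "card B \<le> card (fst ` B \<times> {..q})" using B by (intro card_mono) auto
      also have "\<dots> = Suc q * card (fst ` B)" by (simp add: card_cartesian_product)
      also have "\<dots> \<le> q * card (nbr G `` (fst ` B))" using B by (intro q) auto
      also have "\<dots> = card (E `` B)" by (simp add: E_image card_cartesian_product)
      finally show ?thesis .
    qed
  qed blast
  show thesis
  proof (rule that[OF \<phi>(1)])
    show "(v, fst (\<phi> (v, i))) \<in> nbr G \<and> snd (\<phi> (v, i)) < q" if "v \<in> verts G" "i \<le> q" for v i
      using \<phi>(2)[of "(v, i)"] that by (auto simp: E_def)
  qed
qed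

section \<open>Invariance of the measure under piecewise translations\<close>

locale invariant_measure = labeled_digraph G lab L
  for G :: "('a, 'b) pre_digraph" (structure) and lab :: "'b \<Rightarrow> 'l" and L +
  fixes \<mu> :: "'a set \<Rightarrow> real"
  assumes invariant: "right_invariant_measure G lab L \<mu>"
begin

lemma measure_nonneg: "S \<subseteq> verts G \<Longrightarrow> 0 \<le> \<mu> S"
  using invariant by (auto simp: right_invariant_measure_def)

lemma measure_Un:
  "S \<subseteq> verts G \<Longrightarrow> T \<subseteq> verts G \<Longrightarrow> S \<inter> T = {} \<Longrightarrow> \<mu> (S \<union> T) = \<mu> S + \<mu> T"
  using invariant by (auto simp: right_invariant_measure_def additive_def)

lemma measure_empty: "\<mu> {} = 0"
  using measure_Un[of "{}" "{}"] by simp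

lemma measure_mono:
  assumes "S \<subseteq> T" and "T \<subseteq> verts G"
  shows "\<mu> S \<le> \<mu> T"
proof -
  have "S \<union> (T - S) = T" and "S \<subseteq> verts G" and "T - S \<subseteq> verts G" using assms by auto
  then show ?thesis
    using measure_Un[of S "T - S"] measure_nonneg[of "T - S"] by auto
qed

lemma measure_UN:
  assumes "finite I" and "\<And>i. i \<in> I \<Longrightarrow> S i \<subseteq> verts G" and "disjoint_family_on S I"
  shows "\<mu> (\<Union>i\<in>I. S i) = (\<Sum>i\<in>I. \<mu> (S i))"
  using assms
proof (induction I rule: finite_induct)
  case empty
  then show ?case by (simp add: measure_empty)
next
  case (insert i I)
  have "\<mu> (S i \<union> (\<Union>i\<in>I. S i)) = \<mu> (S i) + \<mu> (\<Union>i\<in>I. S i)"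
    using insert by (intro measure_Un) (auto simp: disjoint_family_on_def)
  then show ?case using insert by (simp add: disjoint_family_on_insert)
qed

lemma measure_translation:
  assumes "g \<in> L" and "\<And>v. v \<in> S \<Longrightarrow> \<exists>e\<in>arcs G. tail G e = v \<and> head G e = f v \<and> lab e = g"
  shows "\<mu> (f ` S) = \<mu> S"
proof -
  have "S \<subseteq> verts G" using assms(2) by force
  then have "translatable G lab g S"
    using assms(2) by (fastforce simp: translatable_def)
  moreover have "translate G lab S g = f ` S"
  proof -
    have "head G e = f (tail G e)" if "e \<in> arcs G" "tail G e \<in> S" "lab e = g" for e
      using that assms(2)[of "tail G e"] out_unique by metis
    then show ?thesis using assms(2) by (force simp: translate_def)
  qed
  ultimately show ?thesis using invariant \<open>g \<in> L\<close> by (simp add: right_invariant_measure_def)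
qed

lemma measure_inverse_translation:
  assumes "g \<in> L" and "\<And>v. v \<in> S \<Longrightarrow> \<exists>e\<in>arcs G. tail G e = f v \<and> head G e = v \<and> lab e = g"
  shows "\<mu> (f ` S) = \<mu> S"
proof -
  have inj: "inj_on f S"
    using assms(2) out_unique by (intro inj_onI) metis
  have "\<mu> (inv_into S f ` f ` S) = \<mu> (f ` S)"
    by (rule measure_translation[OF \<open>g \<in> L\<close>]) (use assms(2) inj in auto)
  then show ?thesis using inj by (simp add: inv_into_image_cancel)
qed

text \<open>Finitely many labels leave finitely many kinds of move: stay, follow \<open>g\<close>,
  or go against \<open>g\<close>. Each kind preserves measure on its piece, and injectivity keeps
  the images of the pieces disjoint, so finite additivity applies on both sides.\<close>

lemma measure_nbr_injection:
  assumes "inj_on f S" and nbr: "\<And>v. v \<in> S \<Longrightarrow> (v, f v) \<in> nbr G"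
  shows "\<mu> (f ` S) = \<mu> S"
proof -
  define moves where "moves = insert None (Some ` (L \<times> (UNIV :: bool set)))"
  define R where "R m v w = (case m of None \<Rightarrow> v = w
      | Some (g, True) \<Rightarrow> \<exists>e\<in>arcs G. tail G e = v \<and> head G e = w \<and> lab e = g
      | Some (g, False) \<Rightarrow> \<exists>e\<in>arcs G. tail G e = w \<and> head G e = v \<and> lab e = g)" for m v w
  have "\<exists>m\<in>moves. R m v (f v)" if "v \<in> S" for v
    using nbr[OF that] unfolding nbr_def
  proof (elim UnE)
    assume "(v, f v) \<in> Id_on (verts G)"
    then show ?thesis by (auto simp: moves_def R_def)
  next
    assume "(v, f v) \<in> arcs_ends G"
    then obtain e where "e \<in> arcs G" "tail G e = v" "head G e = f v"
      by (auto simp: arcs_ends_def arc_to_ends_def)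
    then show ?thesis
      by (intro bexI[of _ "Some (lab e, True)"]) (auto simp: moves_def R_def lab_in)
  next
    assume "(v, f v) \<in> (arcs_ends G)\<inverse>"
    then obtain e where "e \<in> arcs G" "head G e = v" "tail G e = f v"
      by (auto simp: arcs_ends_def arc_to_ends_def)
    then show ?thesis
      by (intro bexI[of _ "Some (lab e, False)"]) (auto simp: moves_def R_def lab_in)
  qed
  \<comment> \<open>A vertex may admit several moves; choosing one for each vertex makes the pieces
    disjoint.\<close>
  then obtain c where c: "\<And>v. v \<in> S \<Longrightarrow> c v \<in> moves \<and> R (c v) v (f v)" by metis
  define piece where "piece m = {v \<in> S. c v = m}" for m
  have S: "S \<subseteq> verts G" and fS: "f ` S \<subseteq> verts G" using nbr nbr_subset by auto
  have S_eq: "S = (\<Union>m\<in>moves. piece m)" using c by (auto simp: piece_def)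
  have fin: "finite moves" by (simp add: moves_def finite_labels)
  have piece_eq: "\<mu> (f ` piece m) = \<mu> (piece m)" if "m \<in> moves" for m
  proof (cases m)
    case None
    then have "f ` piece m = piece m" using c by (force simp: piece_def R_def)
    then show ?thesis by simp
  next
    case (Some gb)
    obtain g b where gb: "gb = (g, b)" by fastforce
    then have g: "g \<in> L" using that Some by (auto simp: moves_def)
    have R: "R (Some (g, b)) v (f v)" if "v \<in> piece m" for v
      using c[of v] that Some gb by (auto simp: piece_def)
    show ?thesis
    proof (cases b)
      case True
      then show ?thesis using R by (intro measure_translation[OF g]) (simp add: R_def)
    next
      case False
      then show ?thesis using R by (intro measure_inverse_translation[OF g]) (simp add: R_def)
    qed
  qed
  have "\<mu> (f ` S) = \<mu> (\<Union>m\<in>moves. f ` piece m)" by (subst S_eq) (simp add: image_UN)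
  also have "\<dots> = (\<Sum>m\<in>moves. \<mu> (f ` piece m))"
    using fS \<open>inj_on f S\<close> by (intro measure_UN[OF fin])
      (auto simp: disjoint_family_on_def piece_def inj_on_def)
  also have "\<dots> = (\<Sum>m\<in>moves. \<mu> (piece m))" by (simp add: piece_eq)
  also have "\<dots> = \<mu> (\<Union>m\<in>moves. piece m)"
    using S by (intro measure_UN[OF fin, symmetric]) (auto simp: disjoint_family_on_def piece_def)
  finally show ?thesis using S_eq by simp
qed

text \<open>Double counting over source copies \<open>i\<close> and target copies \<open>j\<close>:
  for fixed \<open>i\<close> the sets \<open>S i j\<close> partition \<open>V\<close>, while for
  fixed \<open>j\<close> the images \<open>T i j\<close> are disjoint subsets of
  \<open>V\<close>.\<close>

lemma measure_zero_if_copies_inject: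
  fixes q :: nat and \<phi> :: "'a \<times> nat \<Rightarrow> 'a \<times> nat"
  assumes V: "V \<subseteq> verts G" and inj: "inj_on \<phi> (V \<times> {..q})"
    and \<phi>: "\<And>v i. v \<in> V \<Longrightarrow> i \<le> q \<Longrightarrow>
      (v, fst (\<phi> (v, i))) \<in> nbr G \<and> fst (\<phi> (v, i)) \<in> V \<and> snd (\<phi> (v, i)) < q"
  shows "\<mu> V = 0"
proof -
  define S where "S i j = {v \<in> V. snd (\<phi> (v, i)) = j}" for i j
  define T where "T i j = (\<lambda>v. fst (\<phi> (v, i))) ` S i j" for i j
  have T_eq: "\<mu> (T i j) = \<mu> (S i j)" if "i \<le> q" for i j
    unfolding T_def
  proof (rule measure_nbr_injection)
    show "inj_on (\<lambda>v. fst (\<phi> (v, i))) (S i j)"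
    proof (rule inj_onI)
      fix v w assume vw: "v \<in> S i j" "w \<in> S i j" "fst (\<phi> (v, i)) = fst (\<phi> (w, i))"
      then have "\<phi> (v, i) = \<phi> (w, i)" by (auto simp: S_def prod_eq_iff)
      then show "v = w" using vw that inj by (auto simp: S_def inj_on_def)
    qed
  qed (use \<phi> that in \<open>auto simp: S_def\<close>)
  have T_V: "T i j \<subseteq> V" if "i \<le> q" for i j using \<phi> that by (auto simp: T_def S_def)
  \<comment> \<open>A common point of two images in the same target copy would be the image under
    \<phi> of points from two different source copies.\<close>
  have T_disj: "disjoint_family_on (\<lambda>i. T i j) {..q}" for j
  proof (unfold disjoint_family_on_def, intro ballI impI)
    fix i i' assume i: "i \<in> {..q}" "i' \<in> {..q}" "i \<noteq> i'"
    show "T i j \<inter> T i' j = {}"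
    proof (rule ccontr)
      assume "T i j \<inter> T i' j \<noteq> {}"
      then obtain v w where vw: "v \<in> S i j" "w \<in> S i' j" "fst (\<phi> (v, i)) = fst (\<phi> (w, i'))"
        by (auto simp: T_def)
      then have "\<phi> (v, i) = \<phi> (w, i')" by (auto simp: S_def prod_eq_iff)
      then show False using vw i inj by (auto simp: S_def inj_on_def)
    qed
  qed
  have V_split: "\<mu> V = (\<Sum>j<q. \<mu> (S i j))" if "i \<le> q" for i
  proof -
    have "V = (\<Union>j\<in>{..<q}. S i j)" using \<phi> that by (auto simp: S_def)
    moreover have "\<mu> (\<Union>j\<in>{..<q}. S i j) = (\<Sum>j<q. \<mu> (S i j))"
      using V by (intro measure_UN) (auto simp: S_def disjoint_family_on_def)
    ultimately show ?thesis by simp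
  qed
  have "(real q + 1) * \<mu> V = (\<Sum>i\<le>q. \<mu> V)" by simp
  also have "\<dots> = (\<Sum>i\<le>q. \<Sum>j<q. \<mu> (T i j))"
    by (intro sum.cong) (auto simp: V_split T_eq)
  also have "\<dots> = (\<Sum>j<q. \<Sum>i\<le>q. \<mu> (T i j))" by (rule sum.swap)
  also have "\<dots> = (\<Sum>j<q. \<mu> (\<Union>i\<in>{..q}. T i j))"
  proof (intro sum.cong refl measure_UN[symmetric] T_disj)
    show "T i j \<subseteq> verts G" if "i \<in> {..q}" for i j using T_V[of i j] V that by auto
  qed simp
  \<comment> \<open>The images need not cover \<open>V\<close>, so only an inequality results; there
    is one summand fewer than in the first sum, which forces \<mu>(V) \<le> 0.\<close>
  also have "\<dots> \<le> (\<Sum>j<q. \<mu> V)"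
    using T_V V by (intro sum_mono measure_mono) auto
  finally have "\<mu> V \<le> 0" by (simp add: algebra_simps)
  with measure_nonneg[OF V] show ?thesis by simp
qed

end

theorem corollary3p10:
  fixes G P :: "('a, 'b) pre_digraph"
    and lab :: "'b \<Rightarrow> 'l" and L :: "'l set"
    and \<mu> :: "'a set \<Rightarrow> real"
  assumes "labeled_digraph G lab L"
    and "amenable G"
    and "subgraph P G"
    and "\<not> amenable P"
    and "right_invariant_measure G lab L \<mu>"
  shows "\<mu> (verts P) = 0"
proof -
  interpret invariant_measure G lab L \<mu>
    using assms by (simp add: invariant_measure_def invariant_measure_axioms_def)
  interpret P: labeled_digraph P lab L
    using labeled_digraph_subgraph assms by blast
  obtain q :: nat and \<phi> :: "'a \<times> nat \<Rightarrow> 'a \<times> nat" where inj: "inj_on \<phi> (verts P \<times> {..q})"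
    and \<phi>: "\<And>v i. v \<in> verts P \<Longrightarrow> i \<le> q \<Longrightarrow>
      (v, fst (\<phi> (v, i))) \<in> nbr P \<and> snd (\<phi> (v, i)) < q"
    by (rule nonamenable_injection[OF P.wf_digraph_axioms P.bounded_degree \<open>\<not> amenable P\<close>]) (rule that)
  show ?thesis
  proof (rule measure_zero_if_copies_inject[OF _ inj])
    show "verts P \<subseteq> verts G" using \<open>subgraph P G\<close> by (auto simp: subgraph_def)
    show "(v, fst (\<phi> (v, i))) \<in> nbr G \<and> fst (\<phi> (v, i)) \<in> verts P \<and> snd (\<phi> (v, i)) < q"
      if "v \<in> verts P" "i \<le> q" for v i
      \<comment> \<open>Adjacency in \<open>P\<close> is used twice: it keeps the image inside
        \<open>verts P\<close>, and as adjacency in \<open>G\<close> it makes the invariance of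
        \<mu> applicable.\<close>
      using \<phi>[OF that] nbr_mono[OF \<open>subgraph P G\<close>] P.nbr_subset by auto
  qed
qed

end
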